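(* Let $X$ be a Zariski space, and let $f\colon X\to X$ be a continuous surjective map. Fix a point $x\in X$ and a reverse orbit of $x$, that is, a sequence $(x_{-n})_{n=0}^\infty$ of points of $X$ such that $x_0=x$ and $f(x_{-n})=x_{-n+1}$ for all $n\ge1$. Then there exist points $y_1,\dots,y_r\in X$ which form a periodic cycle for $f$ such that \[\frac1n\sum_{k=0}^{n-1}\delta_{x_{-k}}\to\frac1r(\delta_{y_1}+\delta_{y_2}+\cdots+\delta_{y_r})\] weakly as $n\to\infty$. Moreover, the $y_i$ have an explicit description: they are the generic points of the irreducible components of $\overline{\{x_{-n}:n\ge0\}}$.
   Context: A topological space $X$ is Noetherian if every descending chain of closed subsets is eventually constant. A closed set $E\subseteq X$ is irreducible if it is not a union of two proper closed subsets; in a Noetherian space every closed set is uniquely a finite union of irreducible closed sets, none contained in another, called its irreducible components. A Noetherian space $X$ is a Zariski space if every nonempty irreducible closed subset $E\subseteq X$ has a unique generic point, i.e. a unique point $x\in E$ with $\overline{\{x\}}=E$. $\delta_x$ is the Dirac probability measure at $x$. A periodic cycle is a finite set of distinct points cyclically permuted by $f$. Let $SC(X)$ be the space of functions $g-h$ with $g,h\colon X\to\mathbb{R}$ bounded upper semicontinuous (i.e. $\{g\ge r\}$ closed for all $r\in\mathbb{R}$). Finite signed Borel measures $\mu_n$ converge weakly to $\mu$ if $\int_X\tau\,d\mu_n\to\int_X\tau\,d\mu$ for every $\tau\in SC(X)$. *)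

theory Defs
  imports "HOL-Probability.Probability" "HOL-Combinatorics.Orbits"
begin

definition noetherian_space :: "'a topology \<Rightarrow> bool" where
  "noetherian_space X \<longleftrightarrow>
     (\<forall>C :: nat \<Rightarrow> 'a set.
        (\<forall>n. closedin X (C n)) \<and> decseq C \<longrightarrow> (\<exists>N. \<forall>n\<ge>N. C n = C N))"

text \<open>The empty set is irreducible under this definition.\<close>

definition irreducible_closedin :: "'a topology \<Rightarrow> 'a set \<Rightarrow> bool" where
  "irreducible_closedin X E \<longleftrightarrow>
     closedin X E \<and>
     \<not> (\<exists>A B. closedin X A \<and> closedin X B \<and> A \<subset> E \<and> B \<subset> E \<and> E = A \<union> B)"

text \<open>Components are required to be nonempty only so that the empty closed set also has a unique
  decomposition (otherwise both \<open>{}\<close> and \<open>{{}}\<close> would qualify); for nonempty \<open>E\<close> the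
  requirement follows from the other conditions.\<close>

definition irreducible_decomposition :: "'a topology \<Rightarrow> 'a set \<Rightarrow> 'a set set \<Rightarrow> bool" where
  "irreducible_decomposition X E \<C> \<longleftrightarrow>
     finite \<C> \<and> (\<forall>C\<in>\<C>. irreducible_closedin X C \<and> C \<noteq> {}) \<and> \<Union>\<C> = E \<and>
     (\<forall>C\<in>\<C>. \<forall>D\<in>\<C>. C \<subseteq> D \<longrightarrow> C = D)"

definition irreducible_components :: "'a topology \<Rightarrow> 'a set \<Rightarrow> 'a set set" where
  "irreducible_components X E = (THE \<C>. irreducible_decomposition X E \<C>)"

definition generic_point :: "'a topology \<Rightarrow> 'a set \<Rightarrow> 'a \<Rightarrow> bool" where
  "generic_point X E x \<longleftrightarrow> x \<in> E \<and> X closure_of {x} = E"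

definition zariski_space :: "'a topology \<Rightarrow> bool" where
  "zariski_space X \<longleftrightarrow>
     noetherian_space X \<and>
     (\<forall>E. irreducible_closedin X E \<and> E \<noteq> {} \<longrightarrow> (\<exists>!x. generic_point X E x))"

definition reverse_orbit :: "'a topology \<Rightarrow> ('a \<Rightarrow> 'a) \<Rightarrow> 'a \<Rightarrow> (nat \<Rightarrow> 'a) \<Rightarrow> bool" where
  "reverse_orbit X f x xs \<longleftrightarrow>
     (\<forall>n. xs n \<in> topspace X) \<and> xs 0 = x \<and> (\<forall>n\<ge>1. f (xs n) = xs (n - 1))"

definition periodic_cycle :: "'a topology \<Rightarrow> ('a \<Rightarrow> 'a) \<Rightarrow> 'a set \<Rightarrow> bool" where
  "periodic_cycle X f S \<longleftrightarrow> finite S \<and> S \<subseteq> topspace X \<and> cyclic_on f S"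

definition borel_measure_space :: "'a topology \<Rightarrow> 'a measure" where
  "borel_measure_space X = sigma (topspace X) {U. openin X U}"

definition dirac :: "'a topology \<Rightarrow> 'a \<Rightarrow> 'a measure" where
  "dirac X x = return (borel_measure_space X) x"

definition sum_measure :: "'a measure \<Rightarrow> 'i set \<Rightarrow> ('i \<Rightarrow> 'a measure) \<Rightarrow> 'a measure" where
  "sum_measure M I \<mu> = measure_of (space M) (sets M) (\<lambda>A. \<Sum>i\<in>I. emeasure (\<mu> i) A)"

lemma emeasure_sum_measure:
  assumes "\<And>i. i \<in> I \<Longrightarrow> sets (\<mu> i) = sets M" and "A \<in> sets M"
  shows "emeasure (sum_measure M I \<mu>) A = (\<Sum>i\<in>I. emeasure (\<mu> i) A)"
  unfolding sum_measure_def
proof (rule emeasure_measure_of_sigma)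
  show "countably_additive (sets M) (\<lambda>A. \<Sum>i\<in>I. emeasure (\<mu> i) A)"
  proof (rule countably_additiveI)
    fix B :: "nat \<Rightarrow> _"
    assume B: "range B \<subseteq> sets M" "disjoint_family B"
    have "(\<Sum>n. \<Sum>i\<in>I. emeasure (\<mu> i) (B n)) = (\<Sum>i\<in>I. \<Sum>n. emeasure (\<mu> i) (B n))"
      by (rule suminf_sum) simp
    also have "\<dots> = (\<Sum>i\<in>I. emeasure (\<mu> i) (\<Union>n. B n))"
      using assms(1) B by (intro sum.cong refl suminf_emeasure) auto
    finally show "(\<Sum>n. \<Sum>i\<in>I. emeasure (\<mu> i) (B n)) = (\<Sum>i\<in>I. emeasure (\<mu> i) (\<Union>n. B n))" .
  qed
qed (use assms sets.sigma_algebra_axioms in \<open>auto simp: positive_def\<close>)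

definition bounded_usc :: "'a topology \<Rightarrow> ('a \<Rightarrow> real) \<Rightarrow> bool" where
  "bounded_usc X g \<longleftrightarrow>
     bounded (g ` topspace X) \<and> (\<forall>r. closedin X {x \<in> topspace X. g x \<ge> r})"

definition SC :: "'a topology \<Rightarrow> ('a \<Rightarrow> real) set" where
  "SC X = {\<tau>. \<exists>g h. bounded_usc X g \<and> bounded_usc X h \<and> (\<forall>x\<in>topspace X. \<tau> x = g x - h x)}"

definition finite_borel_measure :: "'a topology \<Rightarrow> 'a measure \<Rightarrow> bool" where
  "finite_borel_measure X \<mu> \<longleftrightarrow> finite_measure \<mu> \<and> sets \<mu> = sets (borel_measure_space X)"

text \<open>Weak convergence is tested against \<open>SC X\<close>, not against continuous functions.  It is stated
  for (unsigned) finite Borel measures.\<close>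

definition converges_weakly :: "'a topology \<Rightarrow> (nat \<Rightarrow> 'a measure) \<Rightarrow> 'a measure \<Rightarrow> bool" where
  "converges_weakly X \<mu> \<nu> \<longleftrightarrow>
     (\<forall>n. finite_borel_measure X (\<mu> n)) \<and> finite_borel_measure X \<nu> \<and>
     (\<forall>\<tau>\<in>SC X. (\<lambda>n. \<integral>x. \<tau> x \<partial>\<mu> n) \<longlonglongrightarrow> (\<integral>x. \<tau> x \<partial>\<nu>))"

end

theory Submission
  imports Defs
begin

text \<open>By the chain condition the closures of the tails of the reverse orbit all equal
  \<open>X closure_of (range xs)\<close>, so \<open>f\<close> permutes the generic points of the irreducible components of this
  set; going backwards along this permutation gives a periodic sequence \<open>p\<close> of generic points with
  \<open>xs k \<in> X closure_of {p k}\<close>. A closed set containing no generic point is visited with density zero: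
  a minimal closed set \<open>G\<close> visited with positive upper density satisfies \<open>G \<inter> f\<^sup>-\<^sup>j(G) = G\<close> for some \<open>j \<ge> 1\<close>, since a set of
  positive upper density meets one of its translates in positive upper density, and then
  \<open>G, \<dots>, f\<^sup>j\<^sup>-\<^sup>1(G)\<close> cover the reverse orbit, which forces a generic point into \<open>G\<close>. Hence, for a bounded
  upper semicontinuous \<open>g\<close>, the nonnegative differences \<open>g (xs k) - g (p k)\<close> average to zero.\<close>

subsection \<open>Sets of density zero\<close>

definition zero_density :: "nat set \<Rightarrow> bool" where
  "zero_density A \<longleftrightarrow> (\<lambda>n. real (card (A \<inter> {..<n})) / real n) \<longlonglongrightarrow> 0"

lemma zero_density_mono:
  assumes "zero_density B" and "A \<subseteq> B"
  shows "zero_density A"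
  unfolding zero_density_def
proof (rule tendsto_sandwich[OF _ _ tendsto_const])
  show "(\<lambda>n. real (card (B \<inter> {..<n})) / real n) \<longlonglongrightarrow> 0"
    using assms(1) by (simp add: zero_density_def)
  show "\<forall>\<^sub>F n in sequentially. real (card (A \<inter> {..<n})) / real n \<le> real (card (B \<inter> {..<n})) / real n"
    using assms(2) by (intro always_eventually allI divide_right_mono) (auto intro!: card_mono)
qed simp

lemma zero_density_finite:
  assumes "finite A"
  shows "zero_density A"
  unfolding zero_density_def
proof (rule tendsto_sandwich[OF _ _ tendsto_const])
  show "(\<lambda>n. real (card A) / real n) \<longlonglongrightarrow> 0"
    by (rule lim_const_over_n)
  show "\<forall>\<^sub>F n in sequentially. real (card (A \<inter> {..<n})) / real n \<le> real (card A) / real n"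
    using assms by (intro always_eventually allI divide_right_mono) (auto intro!: card_mono)
qed simp

lemma zero_density_Un:
  assumes "zero_density A" and "zero_density B"
  shows "zero_density (A \<union> B)"
  unfolding zero_density_def
proof (rule tendsto_sandwich[OF _ _ tendsto_const])
  show "(\<lambda>n. real (card (A \<inter> {..<n})) / real n + real (card (B \<inter> {..<n})) / real n) \<longlonglongrightarrow> 0"
    using tendsto_add[of _ 0 _ _ "0::real"] assms by (simp add: zero_density_def)
  have "real (card ((A \<union> B) \<inter> {..<n})) \<le> real (card (A \<inter> {..<n})) + real (card (B \<inter> {..<n}))" for n
    using card_Un_le[of "A \<inter> {..<n}" "B \<inter> {..<n}"] by (simp add: Int_Un_distrib2)
  then show "\<forall>\<^sub>F n in sequentially. real (card ((A \<union> B) \<inter> {..<n})) / real n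
      \<le> real (card (A \<inter> {..<n})) / real n + real (card (B \<inter> {..<n})) / real n"
    by (intro always_eventually allI) (metis add_divide_distrib divide_right_mono of_nat_0_le_iff)
qed simp

lemma zero_density_UN:
  assumes "finite I" and "\<And>i. i \<in> I \<Longrightarrow> zero_density (A i)"
  shows "zero_density (\<Union>i\<in>I. A i)"
  using assms by (induction I rule: finite_induct) (auto intro: zero_density_finite zero_density_Un)

text \<open>Each block of \<open>N\<close> consecutive integers contains at most one element of
  \<open>A\<close>, and the numbers below \<open>n\<close> lie in the blocks with index at most
  \<open>n div N\<close>.\<close>

lemma card_separated_le:
  assumes "N \<ge> 1" and sep: "\<And>k l. k \<in> A \<Longrightarrow> l \<in> A \<Longrightarrow> l < k \<Longrightarrow> l + N \<le> k"
  shows "card (A \<inter> {..<n}) \<le> n div N + 1"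
proof -
  have "inj_on (\<lambda>k. k div N) A"
  proof (rule linorder_inj_onI')
    fix l k assume "l \<in> A" "k \<in> A" "l < k"
    then have "(l + N) div N \<le> k div N"
      by (intro div_le_mono sep)
    then show "l div N \<noteq> k div N"
      using assms(1) by simp
  qed
  then have "card (A \<inter> {..<n}) = card ((\<lambda>k. k div N) ` (A \<inter> {..<n}))"
    by (intro card_image[symmetric]) (auto intro: inj_on_subset)
  also have "\<dots> \<le> card {..n div N}"
    by (intro card_mono) (auto intro!: div_le_mono)
  finally show ?thesis by simp
qed

text \<open>Discarding the elements of \<open>A\<close> with another element less than \<open>N\<close> below leaves a set of
  upper density at most \<open>1 / N\<close>.\<close>

lemma not_zero_density_return:
  assumes "\<not> zero_density A"
  shows "\<exists>j\<ge>1. \<not> zero_density {k \<in> A. j \<le> k \<and> k - j \<in> A}"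
proof (rule ccontr)
  define B where "B j = {k \<in> A. j \<le> k \<and> k - j \<in> A}" for j
  assume "\<not> ?thesis"
  then have B: "zero_density (B j)" if "j \<ge> 1" for j
    using that by (auto simp: B_def)
  have "(\<lambda>n. real (card (A \<inter> {..<n})) / real n) \<longlonglongrightarrow> 0"
  proof (rule LIMSEQ_I)
    fix e :: real assume "e > 0"
    then obtain M where M: "inverse (real (Suc M)) < e / 3"
      using reals_Archimedean[of "e / 3"] by auto
    define N where "N = Suc M"
    define D where "D = (\<Union>j\<in>{1..<N}. B j)"
    have "zero_density D"
      unfolding D_def by (rule zero_density_UN) (auto intro: B)
    moreover have "(\<lambda>n. 1 / real n) \<longlonglongrightarrow> 0"
      by (rule lim_const_over_n)
    ultimately have "(\<lambda>n. 1 / real n + real (card (D \<inter> {..<n})) / real n) \<longlonglongrightarrow> 0"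
      using tendsto_add[of _ 0 _ _ "0::real"] by (simp add: zero_density_def)
    then obtain n0 where n0: "1 / real n + real (card (D \<inter> {..<n})) / real n < e / 3" if "n \<ge> n0" for n
      using \<open>e > 0\<close> by (force dest!: LIMSEQ_D[where r = "e / 3"])
    \<comment> \<open>Starting at \<open>Suc n0\<close> excludes \<open>n = 0\<close>, so that
      \<open>real n\<close> can be cancelled below.\<close>
    have "norm (real (card (A \<inter> {..<n})) / real n - 0) < e" if n: "n \<ge> Suc n0" for n
    proof -
      have "card ((A - D) \<inter> {..<n}) \<le> n div N + 1"
      proof (rule card_separated_le)
        fix k l assume k: "k \<in> A - D" and l: "l \<in> A - D" and "l < k"
        then have "k \<in> B (k - l)" by (auto simp: B_def)
        then have "k - l \<notin> {1..<N}" using k by (auto simp: D_def)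
        then show "l + N \<le> k" using \<open>l < k\<close> by auto
      qed (simp add: N_def)
      moreover have "card (A \<inter> {..<n}) \<le> card ((A - D) \<inter> {..<n}) + card (D \<inter> {..<n})"
        by (rule order_trans[OF card_mono card_Un_le]) auto
      ultimately have "real (card (A \<inter> {..<n})) \<le> real (n div N) + 1 + real (card (D \<inter> {..<n}))"
        by linarith
      also have "real (n div N) \<le> real n / real N"
        using of_nat_mono[OF div_times_less_eq_dividend[of n N], where 'a = real]
        by (simp add: N_def pos_le_divide_eq algebra_simps)
      finally have "real (card (A \<inter> {..<n})) / real n
          \<le> (real n / real N + 1 + real (card (D \<inter> {..<n}))) / real n"
        by (auto intro: divide_right_mono)
      also have "\<dots> = inverse (real N) + (1 / real n + real (card (D \<inter> {..<n})) / real n)"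
        using n by (simp add: add_divide_distrib inverse_eq_divide)
      also have "\<dots> < e / 3 + e / 3"
        using M n0[of n] n by (intro add_strict_mono) (auto simp: N_def)
      finally have "real (card (A \<inter> {..<n})) / real n < e" using \<open>e > 0\<close> by linarith
      then show ?thesis by simp
    qed
    then show "\<exists>no. \<forall>n\<ge>no. norm (real (card (A \<inter> {..<n})) / real n - 0) < e" by blast
  qed
  with assms show False by (simp add: zero_density_def)
qed

section \<open>Averages of real sequences\<close>

text \<open>Terms below a threshold contribute at most that threshold to the average; the others
  occur along a set of density zero and are bounded by \<open>M\<close>.\<close>

lemma average_tendsto_0:
  fixes e :: "nat \<Rightarrow> real"
  assumes nonneg: "\<And>k. 0 \<le> e k" and bd: "\<And>k. e k \<le> M"
    and zd: "\<And>\<epsilon>. \<epsilon> > 0 \<Longrightarrow> zero_density {k. e k \<ge> \<epsilon>}"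
  shows "(\<lambda>n. (\<Sum>k<n. e k) / real n) \<longlonglongrightarrow> 0"
proof (rule LIMSEQ_I)
  fix \<epsilon> :: real assume "\<epsilon> > 0"
  define D where "D = {k. e k \<ge> \<epsilon> / 3}"
  have "M \<ge> 0" using nonneg[of 0] bd[of 0] by linarith
  have "(\<lambda>n. M * (real (card (D \<inter> {..<n})) / real n)) \<longlonglongrightarrow> M * 0"
    using zd[of "\<epsilon> / 3"] \<open>\<epsilon> > 0\<close> unfolding zero_density_def D_def by (intro tendsto_intros) auto
  then obtain n0 where n0: "M * (real (card (D \<inter> {..<n})) / real n) < \<epsilon> / 3" if "n \<ge> n0" for n
    using \<open>\<epsilon> > 0\<close> \<open>M \<ge> 0\<close> by (force dest!: LIMSEQ_D[where r = "\<epsilon> / 3"])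
  have "norm ((\<Sum>k<n. e k) / real n - 0) < \<epsilon>" if n: "n \<ge> Suc n0" for n
  proof -
    have "(\<Sum>k<n. e k) \<le> (\<Sum>k<n. \<epsilon> / 3 + M * indicator D k)"
    proof (rule sum_mono)
      fix k show "e k \<le> \<epsilon> / 3 + M * indicator D k"
        using bd[of k] \<open>\<epsilon> > 0\<close> by (cases "k \<in> D") (auto simp: D_def)
    qed
    also have "\<dots> = real n * (\<epsilon> / 3) + M * real (card (D \<inter> {..<n}))"
      by (simp add: sum.distrib sum_distrib_left[symmetric] indicator_def Int_commute)
    finally have "(\<Sum>k<n. e k) / real n \<le> (real n * (\<epsilon> / 3) + M * real (card (D \<inter> {..<n}))) / real n"
      by (rule divide_right_mono) simp
    also have "\<dots> = \<epsilon> / 3 + M * (real (card (D \<inter> {..<n})) / real n)"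
      using n by (simp add: add_divide_distrib)
    also have "\<dots> < \<epsilon>" using n0[of n] n \<open>\<epsilon> > 0\<close> by linarith
    finally show ?thesis using nonneg by (simp add: sum_nonneg)
  qed
  then show "\<exists>no. \<forall>n\<ge>no. norm ((\<Sum>k<n. e k) / real n - 0) < \<epsilon>" by blast
qed

text \<open>The deviation \<open>P n\<close> of the partial sum from \<open>n\<close> times the mean
  over one period is itself periodic, hence bounded, and tends to zero after division by
  \<open>n\<close>.\<close>

lemma average_periodic:
  fixes h :: "nat \<Rightarrow> real"
  assumes "r \<ge> 1" and per: "\<And>k. h (k + r) = h k"
  shows "(\<lambda>n. (\<Sum>k<n. h k) / real n) \<longlonglongrightarrow> (\<Sum>k<r. h k) / real r"
proof -
  define c where "c = (\<Sum>k<r. h k) / real r"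
  define P where "P n = (\<Sum>k<n. h k) - real n * c" for n
  have per_P: "P (n + r) = P n" for n
  proof (induction n)
    \<comment> \<open>Both sides are 0, because \<open>c\<close> is the mean over one full
      period.\<close>
    case 0
    show ?case using assms(1) by (simp add: P_def c_def)
  next
    case (Suc n)
    then show ?case by (simp add: P_def per algebra_simps)
  qed
  have "P n \<in> P ` {..<r}" for n
  proof (induction n rule: less_induct)
    case (less n)
    then show ?case
      using per_P[of "n - r"] assms(1) less[of "n - r"] by (cases "n < r") auto
  qed
  then have "bounded (range P)"
    by (intro finite_imp_bounded finite_subset[of "range P" "P ` {..<r}"]) auto
  then obtain K where K: "\<And>n. norm (P n) \<le> K"
    by (auto simp: bounded_iff)
  have "(\<lambda>n. P n / real n) \<longlonglongrightarrow> 0"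
  proof (rule Lim_null_comparison)
    show "\<forall>\<^sub>F n in sequentially. norm (P n / real n) \<le> K / real n"
      using K by (intro always_eventually allI) (simp add: divide_right_mono)
  qed (rule lim_const_over_n)
  then have "(\<lambda>n. P n / real n + c) \<longlonglongrightarrow> 0 + c"
    by (intro tendsto_intros)
  moreover have "\<forall>\<^sub>F n in sequentially. P n / real n + c = (\<Sum>k<n. h k) / real n"
    using eventually_gt_at_top[of 0] by eventually_elim (simp add: P_def field_simps)
  ultimately show ?thesis
    unfolding c_def by (simp add: tendsto_cong)
qed

subsection \<open>Noetherian spaces\<close>

text \<open>The chain condition makes strict inclusion of closed sets well-founded.\<close>

lemma noetherian_space_induct [consumes 2, case_names closed]:
  assumes "noetherian_space X" and "closedin X A"
    and step: "\<And>C. closedin X C \<Longrightarrow> (\<And>D. closedin X D \<Longrightarrow> D \<subset> C \<Longrightarrow> P D) \<Longrightarrow> P C"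
  shows "P A"
proof -
  have "wf {(D, C). closedin X D \<and> closedin X C \<and> D \<subset> C}" (is "wf ?R")
    unfolding wf_iff_no_infinite_down_chain
  proof
    assume "\<exists>C. \<forall>i. (C (Suc i), C i) \<in> ?R"
    then obtain C where "\<forall>i. (C (Suc i), C i) \<in> ?R" ..
    then have C: "closedin X (C i)" "C (Suc i) \<subset> C i" for i by simp_all
    then have "decseq C" by (intro decseq_SucI) (simp add: less_imp_le)
    then obtain N where N: "\<And>n. n \<ge> N \<Longrightarrow> C n = C N"
      using assms(1) C(1) unfolding noetherian_space_def by blast
    have "C (Suc N) = C N" by (rule N) simp
    with C(2)[of N] show False by simp
  qed
  then have "closedin X A \<longrightarrow> P A"
  proof (induction A rule: wf_induct_rule)
    case (less C)
    show ?case
    proof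
      assume "closedin X C"
      then show "P C"
      proof (rule step)
        fix D assume "closedin X D" "D \<subset> C"
        with \<open>closedin X C\<close> show "P D" using less.IH[of D] by simp
      qed
    qed
  qed
  then show ?thesis using assms(2) ..
qed

section \<open>Existence and uniqueness of irreducible decompositions\<close>

text \<open>By induction on the family: \<open>C\<close> is the union of its traces on
  \<open>D\<close> and on the remaining members, and one of these traces must be all of
  \<open>C\<close>. Nonemptiness of \<open>C\<close> disposes of the empty family.\<close>

lemma irreducible_subset_Union:
  assumes irr: "irreducible_closedin X C" and "finite \<D>"
    and "\<And>D. D \<in> \<D> \<Longrightarrow> closedin X D" and "C \<noteq> {}" and "C \<subseteq> \<Union>\<D>"
  shows "\<exists>D\<in>\<D>. C \<subseteq> D"
  using assms(2,3,5)
proof (induction \<D> rule: finite_induct)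
  case empty
  then show ?case using \<open>C \<noteq> {}\<close> by simp
next
  case (insert D \<D>)
  have "closedin X C" using irr by (simp add: irreducible_closedin_def)
  then have "closedin X (C \<inter> D)" "closedin X (C \<inter> \<Union>\<D>)"
    using insert by (auto intro!: closedin_Int closedin_Union)
  moreover have "C = (C \<inter> D) \<union> (C \<inter> \<Union>\<D>)" using insert.prems(2) by auto
  ultimately have "\<not> (C \<inter> D \<subset> C \<and> C \<inter> \<Union>\<D> \<subset> C)"
    using irr unfolding irreducible_closedin_def by blast
  then consider "C \<subseteq> D" | "C \<subseteq> \<Union>\<D>" by blast
  then show ?case using insert by cases auto
qed

text \<open>A reducible set splits into two smaller closed sets, and the covers of these together
  cover it. The resulting family may be redundant.\<close>

lemma finite_irreducible_cover_exists:
  assumes "noetherian_space X" and "closedin X E"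
  shows "\<exists>\<C>. finite \<C> \<and> (\<forall>C\<in>\<C>. irreducible_closedin X C \<and> C \<noteq> {}) \<and> \<Union>\<C> = E"
  using assms
proof (induction E rule: noetherian_space_induct)
  case (closed E)
  show ?case
  proof (cases "E = {} \<or> irreducible_closedin X E")
    case True
    \<comment> \<open>The empty set counts as irreducible, but members must be nonempty, so it is
      covered by the empty family.\<close>
    then show ?thesis
      by (intro exI[of _ "if E = {} then {} else {E}"]) auto
  next
    case False
    then obtain A B where AB: "closedin X A" "closedin X B" "A \<subset> E" "B \<subset> E" "E = A \<union> B"
      using closed(1) unfolding irreducible_closedin_def by blast
    obtain \<A> where "finite \<A>" "\<forall>C\<in>\<A>. irreducible_closedin X C \<and> C \<noteq> {}" "\<Union>\<A> = A"
      using closed(2)[OF AB(1,3)] by blast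
    moreover obtain \<B> where "finite \<B>" "\<forall>C\<in>\<B>. irreducible_closedin X C \<and> C \<noteq> {}" "\<Union>\<B> = B"
      using closed(2)[OF AB(2,4)] by blast
    ultimately show ?thesis
      using AB(5) by (intro exI[of _ "\<A> \<union> \<B>"]) auto
  qed
qed

text \<open>The maximal members of a finite irreducible cover still cover, because every member lies
  in a maximal one.\<close>

lemma irreducible_decomposition_exists:
  assumes "noetherian_space X" and "closedin X E"
  shows "\<exists>\<C>. irreducible_decomposition X E \<C>"
proof -
  obtain \<C> where \<C>: "finite \<C>" "\<And>C. C \<in> \<C> \<Longrightarrow> irreducible_closedin X C \<and> C \<noteq> {}" "\<Union>\<C> = E"
    using finite_irreducible_cover_exists[OF assms] by blast
  define \<M> where "\<M> = {C \<in> \<C>. \<forall>D\<in>\<C>. C \<subseteq> D \<longrightarrow> C = D}"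
  have "\<Union>\<M> = \<Union>\<C>"
  proof (intro antisym subsetI)
    fix x assume "x \<in> \<Union>\<C>"
    then obtain C where "C \<in> \<C>" and "x \<in> C" by blast
    obtain D where "D \<in> \<C>" "C \<subseteq> D" "\<forall>B\<in>\<C>. D \<subseteq> B \<longrightarrow> D = B"
      using finite_has_maximal2[OF \<C>(1) \<open>C \<in> \<C>\<close>] by blast
    with \<open>x \<in> C\<close> show "x \<in> \<Union>\<M>" by (auto simp: \<M>_def)
  qed (auto simp: \<M>_def)
  then have "irreducible_decomposition X E \<M>"
    using \<C> by (auto simp: irreducible_decomposition_def \<M>_def)
  then show ?thesis ..
qed

text \<open>\<open>C\<close> lies in some \<open>D\<close>, which lies in some \<open>C'\<close>; as
  \<open>C\<close> and \<open>C'\<close> belong to the same antichain, all three coincide.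
  Exchanging the two decompositions gives uniqueness.\<close>

lemma irreducible_decomposition_mono:
  assumes "irreducible_decomposition X E \<C>" and "irreducible_decomposition X E \<D>"
  shows "\<C> \<subseteq> \<D>"
proof
  fix C assume "C \<in> \<C>"
  have sub: "\<exists>D\<in>\<B>. C \<subseteq> D" if "irreducible_decomposition X E \<A>" "irreducible_decomposition X E \<B>" "C \<in> \<A>" for \<A> \<B> C
    using that by (intro irreducible_subset_Union[of X])
      (auto simp: irreducible_decomposition_def irreducible_closedin_def)
  obtain D where D: "D \<in> \<D>" "C \<subseteq> D" using sub[OF assms \<open>C \<in> \<C>\<close>] by blast
  obtain C' where C': "C' \<in> \<C>" "D \<subseteq> C'" using sub[OF assms(2,1) D(1)] by blast
  have "C \<subseteq> C'" using C' D by auto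
  then have "C = C'"
    using assms(1) \<open>C \<in> \<C>\<close> C'(1) by (simp add: irreducible_decomposition_def)
  then show "C \<in> \<D>" using C' D by auto
qed

lemma irreducible_components_decomposition:
  assumes "noetherian_space X" and "closedin X E"
  shows "irreducible_decomposition X E (irreducible_components X E)"
proof -
  have "\<exists>!\<C>. irreducible_decomposition X E \<C>"
    using irreducible_decomposition_exists[OF assms]
    by (rule ex_ex1I) (intro subset_antisym irreducible_decomposition_mono)
  then show ?thesis
    unfolding irreducible_components_def by (rule theI')
qed

text \<open>If two closed sets cover the closure, one of them contains \<open>p\<close> and
  therefore the whole closure.\<close>

lemma irreducible_closedin_closure_of_point:
  assumes "p \<in> topspace X"
  shows "irreducible_closedin X (X closure_of {p})"
  unfolding irreducible_closedin_def
proof (intro conjI notI)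
  assume "\<exists>A B. closedin X A \<and> closedin X B \<and> A \<subset> X closure_of {p} \<and> B \<subset> X closure_of {p} \<and>
    X closure_of {p} = A \<union> B"
  then obtain A B where AB: "closedin X A" "closedin X B" "A \<subset> X closure_of {p}"
    "B \<subset> X closure_of {p}" "X closure_of {p} = A \<union> B"
    by blast
  have "p \<in> X closure_of {p}" using assms closure_of_subset[of "{p}" X] by simp
  then have "p \<in> A \<or> p \<in> B" using AB(5) by simp
  then have "X closure_of {p} \<subseteq> A \<or> X closure_of {p} \<subseteq> B"
    using AB(1,2) closure_of_minimal[of "{p}" A X] closure_of_minimal[of "{p}" B X] by auto
  then show False using AB(3,4) by blast
qed simp

subsection \<open>Averages of Dirac measures\<close>

lemma space_borel_measure_space [simp]: "space (borel_measure_space X) = topspace X"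
  unfolding borel_measure_space_def by (rule space_measure_of) (auto dest: openin_subset)

lemma sets_sum_measure [simp]: "sets (sum_measure M I \<mu>) = sets M"
  by (simp add: sum_measure_def sets.space_closed sets.sigma_sets_eq)

lemma closedin_borel_measure_space:
  assumes "closedin X C"
  shows "C \<in> sets (borel_measure_space X)"
proof -
  have "openin X (topspace X - C)" using assms by blast
  then have "topspace X - C \<in> sets (borel_measure_space X)"
    unfolding borel_measure_space_def by (subst sets_measure_of) (auto dest: openin_subset)
  then have "space (borel_measure_space X) - (topspace X - C) \<in> sets (borel_measure_space X)"
    by (rule sets.compl_sets)
  then show ?thesis using closedin_subset[OF assms] by (simp add: double_diff)
qed

lemma borel_measurable_bounded_usc:
  assumes "bounded_usc X g"
  shows "g \<in> borel_measurable (borel_measure_space X)"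
  using assms by (intro borel_measurableI_ge) (auto simp: bounded_usc_def intro!: closedin_borel_measure_space)

text \<open>Both measures give \<open>A\<close> the mass \<open>c\<close> times the number of
  indices \<open>i\<close> with \<open>z i\<close> in \<open>A\<close>. The image-measure form
  reduces integrals to finite sums.\<close>

lemma scale_sum_dirac_eq_distr:
  assumes "finite I" and "\<And>i. i \<in> I \<Longrightarrow> z i \<in> topspace X" and "c \<ge> 0"
  shows "scale_measure (ennreal c) (sum_measure (borel_measure_space X) I (\<lambda>i. dirac X (z i)))
    = distr (density (count_space I) (\<lambda>_. ennreal c)) (borel_measure_space X) z"
proof (rule measure_eqI)
  fix A assume "A \<in> sets (scale_measure (ennreal c) (sum_measure (borel_measure_space X) I (\<lambda>i. dirac X (z i))))"
  then have A: "A \<in> sets (borel_measure_space X)"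
    by simp
  have "emeasure (scale_measure (ennreal c) (sum_measure (borel_measure_space X) I (\<lambda>i. dirac X (z i)))) A
      = ennreal c * (\<Sum>i\<in>I. indicator A (z i))"
    using A by (simp add: emeasure_sum_measure dirac_def)
  also have "\<dots> = (\<Sum>i\<in>I. ennreal c * indicator (z -` A \<inter> I) i)"
    by (auto simp: sum_distrib_left intro!: sum.cong split: split_indicator)
  also have "\<dots> = emeasure (distr (density (count_space I) (\<lambda>_. ennreal c)) (borel_measure_space X) z) A"
    using A assms by (subst emeasure_distr)
      (auto simp: emeasure_density nn_integral_count_space_finite)
  finally show "emeasure (scale_measure (ennreal c) (sum_measure (borel_measure_space X) I (\<lambda>i. dirac X (z i)))) A
      = emeasure (distr (density (count_space I) (\<lambda>_. ennreal c)) (borel_measure_space X) z) A" .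
qed simp

lemma finite_borel_measure_scale_sum_dirac:
  assumes "finite I" and z: "\<And>i. i \<in> I \<Longrightarrow> z i \<in> topspace X" and "c \<ge> 0"
  shows "finite_borel_measure X
    (scale_measure (ennreal c) (sum_measure (borel_measure_space X) I (\<lambda>i. dirac X (z i))))"
proof -
  have "emeasure (density (count_space I) (\<lambda>_. ennreal c)) I = ennreal c * of_nat (card I)"
    using \<open>finite I\<close> by (simp add: emeasure_density nn_integral_count_space_finite mult.commute)
  then have "finite_measure (density (count_space I) (\<lambda>_. ennreal c))"
    by (intro finite_measureI) (simp add: ennreal_mult_eq_top_iff)
  then have "finite_measure (distr (density (count_space I) (\<lambda>_. ennreal c)) (borel_measure_space X) z)"
    by (rule finite_measure.finite_measure_distr) (use z in auto)
  then show ?thesis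
    using assms by (simp add: finite_borel_measure_def scale_sum_dirac_eq_distr)
qed

lemma integral_scale_sum_dirac:
  fixes \<tau> :: "'a \<Rightarrow> real"
  assumes "finite I" and z: "\<And>i. i \<in> I \<Longrightarrow> z i \<in> topspace X" and "c \<ge> 0" and "\<tau> \<in> SC X"
  shows "(\<integral>x. \<tau> x \<partial>scale_measure (ennreal c) (sum_measure (borel_measure_space X) I (\<lambda>i. dirac X (z i))))
    = c * (\<Sum>i\<in>I. \<tau> (z i))"
proof -
  obtain g h where "bounded_usc X g" "bounded_usc X h" and \<tau>: "\<And>x. x \<in> topspace X \<Longrightarrow> \<tau> x = g x - h x"
    using assms(4) by (auto simp: SC_def)
  then have "(\<lambda>x. g x - h x) \<in> borel_measurable (borel_measure_space X)"
    by (intro borel_measurable_diff borel_measurable_bounded_usc)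
  \<comment> \<open>\<open>\<tau>\<close> agrees with the difference only on
    \<open>topspace X\<close>, which is the whole space of the measure.\<close>
  then have meas: "\<tau> \<in> borel_measurable (borel_measure_space X)"
    by (subst measurable_cong[where g = "\<lambda>x. g x - h x"]) (auto simp: \<tau>)
  have "(\<integral>x. \<tau> x \<partial>distr (density (count_space I) (\<lambda>_. ennreal c)) (borel_measure_space X) z)
      = (\<integral>i. \<tau> (z i) \<partial>density (count_space I) (\<lambda>_. ennreal c))"
    using z meas by (intro integral_distr) auto
  also have "\<dots> = (\<integral>i. c *\<^sub>R \<tau> (z i) \<partial>count_space I)"
    using \<open>c \<ge> 0\<close> by (intro integral_density) auto
  also have "\<dots> = c * (\<Sum>i\<in>I. \<tau> (z i))"
    using \<open>finite I\<close> by (simp add: lebesgue_integral_count_space_finite sum_distrib_left)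
  finally show ?thesis
    using assms(1-3) by (simp add: scale_sum_dirac_eq_distr)
qed

subsection \<open>Reverse orbits in Zariski spaces\<close>

locale zariski_reverse_orbit =
  fixes X :: "'a topology" and f :: "'a \<Rightarrow> 'a" and xs :: "nat \<Rightarrow> 'a"
  assumes zariski: "zariski_space X"
    and cont: "continuous_map X X f"
    and xs_topspace: "xs n \<in> topspace X"
    and f_xs_Suc: "f (xs (Suc n)) = xs n"
begin

definition generics :: "'a set" where
  "generics = {p. \<exists>C \<in> irreducible_components X (X closure_of (range xs)). generic_point X C p}"

lemma decomposition:
  "irreducible_decomposition X (X closure_of (range xs)) (irreducible_components X (X closure_of (range xs)))"
  using zariski by (intro irreducible_components_decomposition) (auto simp: zariski_space_def)

text \<open>Both points are generic in the irreducible closed set \<open>X closure_of {p}\<close>;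
  in other words, a Zariski space is T0.\<close>

lemma generic_point_unique:
  assumes "p \<in> topspace X" and "q \<in> topspace X" and "X closure_of {p} = X closure_of {q}"
  shows "p = q"
proof -
  have "\<exists>!x. generic_point X (X closure_of {p}) x"
    using zariski irreducible_closedin_closure_of_point[OF assms(1)] assms(1) closure_of_subset[of "{p}" X]
    unfolding zariski_space_def by blast
  moreover have "generic_point X (X closure_of {p}) p" "generic_point X (X closure_of {p}) q"
    using assms closure_of_subset[of "{p}" X] closure_of_subset[of "{q}" X] by (auto simp: generic_point_def)
  ultimately show ?thesis by blast
qed

lemma in_closure_of_point:
  assumes "p \<in> topspace X"
  shows "p \<in> X closure_of {p}"
  using assms closure_of_subset[of "{p}" X] by simp

lemma closure_of_point_subset:
  assumes "p \<in> C" and "closedin X C"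
  shows "X closure_of {p} \<subseteq> C"
  using assms by (intro closure_of_minimal) auto

lemma generics_topspace:
  assumes "p \<in> generics"
  shows "p \<in> topspace X"
proof -
  obtain C where C: "C \<in> irreducible_components X (X closure_of (range xs))" "generic_point X C p"
    using assms by (auto simp: generics_def)
  then have "closedin X C"
    using decomposition by (auto simp: irreducible_decomposition_def irreducible_closedin_def)
  then show ?thesis
    using C(2) closedin_subset by (auto simp: generic_point_def)
qed

text \<open>Taking closures of points embeds \<open>generics\<close> into the finite set of
  components.\<close>

lemma finite_generics: "finite generics"
proof -
  let ?\<C> = "irreducible_components X (X closure_of (range xs))"
  have "(\<lambda>p. X closure_of {p}) ` generics \<subseteq> ?\<C>"
    by (auto simp: generics_def generic_point_def)
  moreover have "finite ?\<C>"
    using decomposition by (simp add: irreducible_decomposition_def)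
  moreover have "inj_on (\<lambda>p. X closure_of {p}) generics"
    by (intro inj_onI generic_point_unique generics_topspace)
  ultimately show ?thesis by (metis finite_imageD finite_subset)
qed

text \<open>Every component is the closure of its generic point; this lets points replace components
  in what follows.\<close>

lemma closure_of_orbit_eq: "X closure_of (range xs) = (\<Union>p\<in>generics. X closure_of {p})"
proof -
  let ?\<C> = "irreducible_components X (X closure_of (range xs))"
  have "\<exists>p\<in>generics. X closure_of {p} = C" if "C \<in> ?\<C>" for C
  proof -
    have "irreducible_closedin X C" "C \<noteq> {}"
      using decomposition that by (auto simp: irreducible_decomposition_def)
    then obtain p where "generic_point X C p"
      using zariski unfolding zariski_space_def by blast
    then show ?thesis using that by (auto simp: generics_def generic_point_def)
  qed
  moreover have "X closure_of {p} \<in> ?\<C>" if "p \<in> generics" for p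
    using that by (auto simp: generics_def generic_point_def)
  ultimately have "?\<C> = (\<lambda>p. X closure_of {p}) ` generics" by blast
  then show ?thesis using decomposition by (simp add: irreducible_decomposition_def)
qed

text \<open>A generic point in the closure of another would give an inclusion between two
  components.\<close>

lemma generics_antichain:
  assumes "p \<in> generics" and "q \<in> generics" and "q \<in> X closure_of {p}"
  shows "q = p"
proof -
  let ?\<C> = "irreducible_components X (X closure_of (range xs))"
  have "X closure_of {p} \<in> ?\<C>" "X closure_of {q} \<in> ?\<C>"
    using assms by (auto simp: generics_def generic_point_def)
  moreover have "X closure_of {q} \<subseteq> X closure_of {p}"
    using assms by (intro closure_of_point_subset) auto
  ultimately have "X closure_of {q} = X closure_of {p}"
    using decomposition by (simp add: irreducible_decomposition_def)
  then show ?thesis using assms by (intro generic_point_unique generics_topspace)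
qed

lemma xs_in_closure_of_generic: "\<exists>p\<in>generics. xs n \<in> X closure_of {p}"
proof -
  have "range xs \<subseteq> X closure_of (range xs)"
    using xs_topspace by (intro closure_of_subset) auto
  then show ?thesis using closure_of_orbit_eq by auto
qed

text \<open>Used to place a generic point in a finite union of closed sets: it suffices that the
  union covers the orbit.\<close>

lemma generic_in_closed:
  assumes "p \<in> generics" and "closedin X C" and "range xs \<subseteq> C"
  shows "p \<in> C"
proof -
  have "p \<in> X closure_of (range xs)"
    using assms(1) closure_of_orbit_eq in_closure_of_point generics_topspace by blast
  then show ?thesis using closure_of_minimal assms(2,3) by blast
qed

section \<open>The action of \<open>f\<close> on the orbit closure and on the generic points\<close>

lemma f_funpow_xs: "(f ^^ k) (xs (n + k)) = xs n"
proof (induction k arbitrary: n)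
  case (Suc k)
  then show ?case by (simp add: funpow_Suc_right f_xs_Suc del: funpow.simps)
qed simp

lemma continuous_map_funpow: "continuous_map X X (f ^^ k)"
  by (induction k) (simp_all add: id_def continuous_map_compose[OF _ cont] del: o_apply)

lemma f_topspace: "p \<in> topspace X \<Longrightarrow> f p \<in> topspace X"
  using continuous_map_image_subset_topspace[OF cont] by blast

lemma funpow_closure_of_point:
  assumes "q \<in> X closure_of {p}"
  shows "(f ^^ k) q \<in> X closure_of {(f ^^ k) p}"
  using assms continuous_map_image_closure_subset[OF continuous_map_funpow, of k "{p}"] by auto

lemma f_closure_of_point:
  assumes "q \<in> X closure_of {p}"
  shows "f q \<in> X closure_of {f p}"
  using funpow_closure_of_point[OF assms, of 1] by simp

text \<open>If the closures of the tails are constant from \<open>N\<close> on, apply \<open>f ^^ N\<close> to \<open>xs N\<close>, which lies in the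
  closure of the tail after \<open>N\<close>.\<close>

lemma xs_0_in_closure_of_tail: "xs 0 \<in> X closure_of (xs ` {1..})"
proof -
  define C where "C n = X closure_of (xs ` {n..})" for n
  have "decseq C"
    unfolding C_def by (intro decseq_SucI closure_of_mono image_mono) auto
  moreover have "closedin X (C n)" for n by (simp add: C_def)
  ultimately obtain N where N: "\<And>n. n \<ge> N \<Longrightarrow> C n = C N"
    using zariski unfolding zariski_space_def noetherian_space_def by blast
  have "xs N \<in> C N"
    using closure_of_subset[of "xs ` {N..}" X] xs_topspace by (auto simp: C_def)
  then have "xs N \<in> C (Suc N)" using N[of "Suc N"] by simp
  then have "(f ^^ N) (xs N) \<in> X closure_of ((f ^^ N) ` xs ` {Suc N..})"
    using continuous_map_image_closure_subset[OF continuous_map_funpow, of N "xs ` {Suc N..}"]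
    by (auto simp: C_def)
  moreover have "(f ^^ N) ` xs ` {Suc N..} \<subseteq> xs ` {1..}"
  proof clarsimp
    fix n assume "Suc N \<le> n"
    then show "(f ^^ N) (xs n) \<in> xs ` {Suc 0..}"
      using f_funpow_xs[of N "n - N"] by auto
  qed
  ultimately show ?thesis
    using closure_of_mono f_funpow_xs[of N 0] by fastforce
qed

text \<open>\<open>f\<close> moves \<open>xs (Suc m)\<close> to \<open>xs m\<close>, so only
  \<open>f (xs 0)\<close> could escape. Since \<open>xs 0\<close> is a limit of the later points,
  \<open>f (xs 0)\<close> is a limit of their images, which lie in the orbit.\<close>

lemma f_closure_of_orbit:
  assumes "p \<in> X closure_of (range xs)"
  shows "f p \<in> X closure_of (range xs)"
proof -
  have "f (xs n) \<in> X closure_of (range xs)" for n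
  proof (cases n)
    case 0
    have "f (xs 0) \<in> X closure_of (f ` xs ` {1..})"
      using xs_0_in_closure_of_tail continuous_map_image_closure_subset[OF cont] by blast
    moreover have "f ` xs ` {1..} \<subseteq> range xs"
      using f_xs_Suc by (auto simp: image_iff) (metis Suc_le_D)
    ultimately show ?thesis using 0 closure_of_mono by blast
  next
    case (Suc m)
    then show ?thesis
      using f_xs_Suc closure_of_subset[of "range xs" X] xs_topspace by auto
  qed
  then have "X closure_of (f ` range xs) \<subseteq> X closure_of (range xs)"
    by (intro closure_of_minimal) auto
  then show ?thesis
    using assms continuous_map_image_closure_subset[OF cont, of "range xs"] by blast
qed

text \<open>As \<open>xs n\<close> is the image of \<open>xs (Suc n)\<close>, the closures of the
  points \<open>f y\<close> with \<open>y\<close> generic cover the orbit, so \<open>z\<close> lies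
  in one of them. That \<open>f y\<close> lies in turn below a generic \<open>w\<close>; the
  antichain property gives \<open>w = z\<close>, and then \<open>f y = z\<close>.\<close>

lemma generics_subset_image: "generics \<subseteq> f ` generics"
proof
  fix z assume z: "z \<in> generics"
  let ?C = "\<Union>y\<in>generics. X closure_of {f y}"
  have "xs n \<in> ?C" for n
    using xs_in_closure_of_generic[of "Suc n"] f_closure_of_point[of "xs (Suc n)"] f_xs_Suc by auto
  moreover have "closedin X ?C" using finite_generics by (intro closedin_Union) auto
  ultimately have "z \<in> ?C" using z generic_in_closed[of z ?C] by blast
  then obtain y where y: "y \<in> generics" "z \<in> X closure_of {f y}" by blast
  then have "f y \<in> X closure_of (range xs)"
    using f_closure_of_orbit closure_of_orbit_eq in_closure_of_point generics_topspace by blast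
  then obtain w where w: "w \<in> generics" "f y \<in> X closure_of {w}"
    using closure_of_orbit_eq by auto
  have sub: "X closure_of {f y} \<subseteq> X closure_of {w}"
    using w by (intro closure_of_point_subset) auto
  then have "z = w" using y w z generics_antichain by blast
  moreover have "X closure_of {z} \<subseteq> X closure_of {f y}"
    using y by (intro closure_of_point_subset) auto
  ultimately have "X closure_of {f y} = X closure_of {z}" using sub by auto
  then have "f y = z"
    using y z f_topspace generics_topspace by (intro generic_point_unique) auto
  then show "z \<in> f ` generics" using y by blast
qed

lemma bij_betw_generics: "bij_betw f generics generics"
proof -
  have "card (f ` generics) \<le> card generics"
    using finite_generics by (rule card_image_le)
  then have "f ` generics = generics"
    using generics_subset_image finite_generics by (metis card_seteq finite_imageI)
  then show ?thesis
    using finite_generics by (auto simp: bij_betw_def intro: eq_card_imp_inj_on)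
qed

lemma funpow_generics: "p \<in> generics \<Longrightarrow> (f ^^ k) p \<in> generics"
  using bij_betw_generics by (induction k) (auto simp: bij_betw_def)

section \<open>Closed sets visited with positive upper density\<close>

lemma minimal_visited_closed_contains_generic:
  assumes G: "closedin X G" "\<not> zero_density {k. xs k \<in> G}"
    and min: "\<And>D. closedin X D \<Longrightarrow> D \<subset> G \<Longrightarrow> zero_density {k. xs k \<in> D}"
  shows "\<exists>p\<in>generics. p \<in> G"
proof -
  define A where "A = {k. xs k \<in> G}"
  obtain j where j: "j \<ge> 1" "\<not> zero_density {k \<in> A. j \<le> k \<and> k - j \<in> A}"
    using not_zero_density_return[of A] G(2) by (auto simp: A_def)
  define G' where "G' = {p \<in> G. (f ^^ j) p \<in> G}"
  have "{k \<in> A. j \<le> k \<and> k - j \<in> A} \<subseteq> {k. xs k \<in> G'}"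
  proof clarify
    fix k assume "k \<in> A" "j \<le> k" "k - j \<in> A"
    then show "xs k \<in> G'" using f_funpow_xs[of j "k - j"] by (simp add: A_def G'_def)
  qed
  \<comment> \<open>\<open>G'\<close> is closed and still visited too often to be a proper subset of
    the minimal \<open>G\<close>; hence \<open>f ^^ j\<close> maps \<open>G\<close> into
    itself.\<close>
  then have "\<not> zero_density {k. xs k \<in> G'}" using j(2) zero_density_mono by blast
  moreover have "closedin X G'"
    unfolding G'_def using G(1) continuous_map_funpow by (intro closedin_continuous_map_preimage_gen)
  moreover have "G' \<subseteq> G" by (auto simp: G'_def)
  ultimately have "G' = G" using min[of G'] by blast
  then have inv: "(f ^^ j) p \<in> G" if "p \<in> G" for p
    using that by (auto simp: G'_def)
  have inv_mult: "(f ^^ (j * q)) p \<in> G" if "p \<in> G" for p q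
    using that by (induction q arbitrary: p) (auto simp: funpow_add inv)
  have "infinite A" using G(2) zero_density_finite by (auto simp: A_def)
  let ?C = "\<Union>i\<in>{..<j}. X closure_of ((f ^^ i) ` G)"
  have "xs k \<in> ?C" for k
  proof -
    \<comment> \<open>The point \<open>xs k\<close> is reached from a later visit
      \<open>xs a\<close> to \<open>G\<close> by \<open>a - k\<close> steps of \<open>f\<close>;
      full multiples of \<open>j\<close> stay in \<open>G\<close>, leaving the remainder
      \<open>i\<close>.\<close>
    obtain a where a: "a \<in> A" "k \<le> a"
      using \<open>infinite A\<close> infinite_nat_iff_unbounded_le by blast
    define q i where "q = (a - k) div j" and "i = (a - k) mod j"
    have "a - k = i + j * q" by (simp add: q_def i_def)
    then have "a = k + (i + j * q)" using a(2) by linarith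
    then have "xs k = (f ^^ (i + j * q)) (xs a)"
      using f_funpow_xs[of "i + j * q" k] by simp
    also have "\<dots> = (f ^^ i) ((f ^^ (j * q)) (xs a))" by (simp add: funpow_add)
    finally have "xs k \<in> (f ^^ i) ` G" using inv_mult a(1) by (auto simp: A_def)
    moreover have "(f ^^ i) ` G \<subseteq> topspace X"
      using continuous_map_image_subset_topspace[OF continuous_map_funpow] closedin_subset[OF G(1)] by blast
    ultimately have "xs k \<in> X closure_of ((f ^^ i) ` G)"
      using closure_of_subset by blast
    moreover have "i < j" using j(1) by (simp add: i_def)
    ultimately show ?thesis by blast
  qed
  moreover have "closedin X ?C" by (intro closedin_Union) auto
  moreover obtain p where p: "p \<in> generics" using xs_in_closure_of_generic by blast
  ultimately have "p \<in> ?C" using generic_in_closed[of p ?C] by blast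
  then obtain i where i: "i < j" "p \<in> X closure_of ((f ^^ i) ` G)" by blast
  \<comment> \<open>Completing \<open>i\<close> steps to \<open>j\<close> brings the image of
    \<open>p\<close> back into \<open>G\<close>, and this image is again generic.\<close>
  have "(f ^^ (j - i)) p \<in> X closure_of ((f ^^ (j - i)) ` (f ^^ i) ` G)"
    using i(2) continuous_map_image_closure_subset[OF continuous_map_funpow] by blast
  also have "(f ^^ (j - i)) ` (f ^^ i) ` G = (f ^^ j) ` G"
    using i(1) funpow_add[of "j - i" i f] by (simp add: image_comp)
  also have "X closure_of ((f ^^ j) ` G) \<subseteq> G"
    using inv G(1) by (intro closure_of_minimal) auto
  finally have "(f ^^ (j - i)) p \<in> G" .
  then show ?thesis using p funpow_generics by blast
qed

text \<open>Noetherian induction passes to smaller visited closed sets until the minimal case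
  applies.\<close>

lemma visited_closed_contains_generic:
  assumes "closedin X F" and "\<not> zero_density {k. xs k \<in> F}"
  shows "\<exists>p\<in>generics. p \<in> F"
proof -
  have "noetherian_space X" using zariski by (simp add: zariski_space_def)
  then show ?thesis
    using assms
  proof (induction F rule: noetherian_space_induct)
    case (closed F)
    show ?case
    proof (cases "\<exists>D. closedin X D \<and> D \<subset> F \<and> \<not> zero_density {k. xs k \<in> D}")
      case True
      then obtain D where D: "closedin X D" "D \<subset> F" "\<not> zero_density {k. xs k \<in> D}" by blast
      show ?thesis using closed.IH[OF D] D(2) by blast
    next
      case False
      show ?thesis
        by (rule minimal_visited_closed_contains_generic) (use closed.hyps closed.prems False in auto)
    qed
  qed
qed

section \<open>A periodic sequence of generic points accompanying the orbit\<close>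

lemma generic_reverse_orbit:
  obtains p where "\<And>k. p k \<in> generics" "\<And>k. f (p (Suc k)) = p k" "\<And>k. xs k \<in> X closure_of {p k}"
proof -
  define g where "g = inv_into generics f"
  have g: "g q \<in> generics" "f (g q) = q" if "q \<in> generics" for q
    using that bij_betw_generics unfolding g_def
    by (auto simp: bij_betw_def inv_into_into f_inv_into_f)
  have g_pow: "(g ^^ k) q \<in> generics" if "q \<in> generics" for k q
    using that g by (induction k) auto
  \<comment> \<open>The witness is \<open>(f ^^ k) p\<close> for a generic \<open>p\<close> whose
    closure contains \<open>xs k\<close>; it depends on \<open>k\<close>.\<close>
  have "\<exists>q\<in>generics. xs k \<in> X closure_of {(g ^^ k) q}" for k
  proof -
    obtain p where p: "p \<in> generics" "xs k \<in> X closure_of {p}"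
      using xs_in_closure_of_generic by blast
    have "(g ^^ i) ((f ^^ i) p) = p" for i
    proof (induction i)
      case (Suc i)
      have "g (f ((f ^^ i) p)) = (f ^^ i) p"
        using bij_betw_generics funpow_generics[OF p(1)] by (auto simp: g_def bij_betw_def)
      then show ?case using Suc by (simp add: funpow_swap1)
    qed simp
    then show ?thesis using p funpow_generics by metis
  qed
  then obtain Q where Q: "\<And>k. Q k \<in> generics" "\<And>k. xs k \<in> X closure_of {(g ^^ k) (Q k)}"
    by metis
  have "finite (range Q)"
    using Q(1) finite_generics by (meson finite_subset image_subsetI)
  \<comment> \<open>By pigeonhole one starting point serves infinitely many \<open>k\<close>;
    applying \<open>f\<close> then carries the relation down to all smaller indices.\<close>
  then obtain k0 where inf: "infinite {k. Q k = Q k0}"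
    using pigeonhole_infinite[of UNIV Q] by auto
  define q where "q = Q k0"
  have q: "q \<in> generics" using Q(1) by (simp add: q_def)
  have f_g: "f ((g ^^ Suc k) q) = (g ^^ k) q" for k
    using g(2) g_pow[OF q] by simp
  have down: "xs k \<in> X closure_of {(g ^^ k) q}" if "xs (k + m) \<in> X closure_of {(g ^^ (k + m)) q}" for k m
    using that
  proof (induction m)
    case (Suc m)
    have "f (xs (Suc (k + m))) \<in> X closure_of {f ((g ^^ Suc (k + m)) q)}"
      using Suc.prems unfolding add_Suc_right by (rule f_closure_of_point)
    then have "xs (k + m) \<in> X closure_of {(g ^^ (k + m)) q}"
      unfolding f_g f_xs_Suc .
    then show ?case by (rule Suc.IH)
  qed simp
  have "xs k \<in> X closure_of {(g ^^ k) q}" for k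
  proof -
    obtain l where "l \<ge> k" "Q l = Q k0"
      using inf unfolding infinite_nat_iff_unbounded_le by auto
    then have "xs (k + (l - k)) \<in> X closure_of {(g ^^ (k + (l - k))) q}"
      using Q(2)[of l] by (simp add: q_def)
    then show ?thesis by (rule down)
  qed
  then show thesis by (rule that[of "\<lambda>k. (g ^^ k) q", OF g_pow[OF q] f_g])
qed

text \<open>The closures of the \<open>p k\<close> cover the orbit, so every generic point occurs in
  \<open>p\<close>. Injectivity of \<open>f\<close> on \<open>generics\<close> turns any repetition
  into a return to \<open>p 0\<close>, and the least return time is the period
  \<open>r\<close>.\<close>

lemma generics_periodic:
  obtains p r where "r \<ge> (1::nat)" "inj_on p {1..r}" "p ` {1..r} = generics" "\<And>k. p k \<in> generics"
    "\<And>k. p (k + r) = p k" "\<And>k. f (p (Suc k)) = p k" "\<And>k. xs k \<in> X closure_of {p k}"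
proof -
  obtain p where p: "\<And>k. p k \<in> generics" "\<And>k. f (p (Suc k)) = p k"
    "\<And>k. xs k \<in> X closure_of {p k}"
    using generic_reverse_orbit by blast
  have inj_f: "inj_on f generics" using bij_betw_generics by (simp add: bij_betw_def)
  have shift: "p (k + d) = p k \<longleftrightarrow> p d = p 0" for k d
  proof (induction k)
    case (Suc k)
    have "p (Suc k + d) = p (Suc k) \<longleftrightarrow> f (p (Suc (k + d))) = f (p (Suc k))"
      using inj_f p(1) by (simp add: inj_on_eq_iff)
    then show ?case using Suc p(2) by simp
  qed simp
  have "range p = generics"
  proof (intro antisym subsetI)
    fix z assume z: "z \<in> generics"
    let ?C = "\<Union>y\<in>range p. X closure_of {y}"
    have fin: "finite (range p)" using p(1) finite_generics by (meson finite_subset image_subsetI)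
    have "xs k \<in> ?C" for k using p(3) by auto
    moreover have "closedin X ?C" using fin by (intro closedin_Union) auto
    ultimately have "z \<in> ?C" using z generic_in_closed[of z ?C] by blast
    then obtain k where "z \<in> X closure_of {p k}" by auto
    then have "z = p k" by (rule generics_antichain[OF p(1) z])
    then show "z \<in> range p" by simp
  qed (use p(1) in auto)
  have "\<not> inj p"
    using \<open>range p = generics\<close> finite_generics finite_imageD[of p UNIV] by auto
  then obtain a b where "a < b" "p b = p a"
    using linorder_injI[of p] by metis
  then obtain d where d: "d > 0" "p (a + d) = p a"
    using less_imp_add_positive[of a b] by auto
  define r where "r = (LEAST r. r > 0 \<and> p r = p 0)"
  have r: "r > 0" "p r = p 0"
    using LeastI[of "\<lambda>r. r > 0 \<and> p r = p 0" d] d shift[of a d] by (auto simp: r_def)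
  have r_min: "\<not> (0 < d \<and> p d = p 0)" if "d < r" for d
    using that not_less_Least[of d "\<lambda>r. r > 0 \<and> p r = p 0"] unfolding r_def by simp
  have per: "p (k + r) = p k" for k using shift r by simp
  have "inj_on p {1..r}"
  proof (rule linorder_inj_onI')
    fix a b assume "a \<in> {1..r}" "b \<in> {1..r}" "a < b"
    then show "p a \<noteq> p b" using shift[of a "b - a"] r_min[of "b - a"] by auto
  qed
  moreover have "p k \<in> p ` {1..r}" for k
  proof (induction k rule: less_induct)
    case (less k)
    consider "k = 0" | "k \<in> {1..r}" | "k > r" by fastforce
    then show ?case
    proof cases
      case 1
      then show ?thesis using r by (intro image_eqI[of _ _ r]) auto
    next
      case 3
      then show ?thesis using less[of "k - r"] per[of "k - r"] r(1) by simp
    qed auto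
  qed
  then have "range p \<subseteq> p ` {1..r}" by (rule image_subsetI)
  then have "p ` {1..r} = generics"
    using \<open>range p = generics\<close> image_mono[OF subset_UNIV, of p "{1..r}"] by simp
  ultimately show thesis
    using r(1) by (intro that[of r p] per p) simp_all
qed

lemma cyclic_on_generics: "cyclic_on f generics"
proof -
  obtain p r where r: "r \<ge> (1::nat)" and img: "p ` {1..r} = generics" and per: "\<And>k. p (k + r) = p k"
    and fp: "\<And>k. f (p (Suc k)) = p k"
    by (rule generics_periodic) (rule that; assumption)
  have "p r \<in> generics" using img r by auto
  moreover have pow: "(f ^^ i) (p (k + i)) = p k" for i k
  proof (induction i arbitrary: k)
    case (Suc i)
    then show ?case by (simp add: funpow_Suc_right fp del: funpow.simps)
  qed simp
  have "generics = orbit f (p r)"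
  proof (intro antisym subsetI)
    fix z assume "z \<in> generics"
    then obtain k where k: "k \<in> {1..r}" "z = p k" using img by blast
    \<comment> \<open>\<open>f\<close> runs through \<open>p\<close> backwards, here from
      \<open>p (2 * r) = p r\<close> down to \<open>p k\<close>. The exponent \<open>r - k\<close>
      would be 0 for \<open>k = r\<close>, while \<open>orbit\<close> needs a positive one.\<close>
    then have "z = (f ^^ (2 * r - k)) (p r)"
      using pow[of "2 * r - k" k] per[of r] by (simp add: mult_2)
    moreover have "2 * r - k > 0" using k r by auto
    ultimately show "z \<in> orbit f (p r)" by (auto simp: orbit_altdef)
  next
    fix z assume "z \<in> orbit f (p r)"
    then show "z \<in> generics"
      using \<open>p r \<in> generics\<close> funpow_generics by (auto simp: orbit_altdef)
  qed
  ultimately show ?thesis by (auto simp: cyclic_on_def)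
qed

text \<open>An upper semicontinuous \<open>g\<close> is at least \<open>g (p k)\<close> on the closure of \<open>p k\<close>, and exceeds it by a
  fixed amount only on a closed set without generic points.\<close>

lemma average_usc:
  assumes "bounded_usc X g" and p: "\<And>k. p k \<in> generics" "\<And>k. xs k \<in> X closure_of {p k}"
    and r: "r \<ge> 1" and per: "\<And>k. p (k + r) = p k"
  shows "(\<lambda>n. (\<Sum>k<n. g (xs k)) / real n) \<longlonglongrightarrow> (\<Sum>k<r. g (p k)) / real r"
proof -
  have cl: "closedin X {x \<in> topspace X. g x \<ge> c}" for c
    using assms(1) by (simp add: bounded_usc_def)
  obtain M where M: "\<And>x. x \<in> topspace X \<Longrightarrow> \<bar>g x\<bar> \<le> M"
    using assms(1) by (auto simp: bounded_usc_def bounded_iff)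
  have "(\<lambda>n. (\<Sum>k<n. g (xs k) - g (p k)) / real n) \<longlonglongrightarrow> 0"
  proof (rule average_tendsto_0)
    fix k
    have "X closure_of {p k} \<subseteq> {x \<in> topspace X. g x \<ge> g (p k)}"
      using p(1) generics_topspace by (intro closure_of_point_subset cl) auto
    then show "0 \<le> g (xs k) - g (p k)" using p(2) by auto
    show "g (xs k) - g (p k) \<le> 2 * M"
      using M[OF xs_topspace[of k]] M[OF generics_topspace[OF p(1)[of k]]] by linarith
  next
    fix \<epsilon> :: real assume "\<epsilon> > 0"
    define F where "F y = X closure_of {y} \<inter> {x \<in> topspace X. g x \<ge> g y + \<epsilon>}" for y
    have "zero_density {k. xs k \<in> F y}" if "y \<in> generics" for y
    proof (rule ccontr)
      assume "\<not> zero_density {k. xs k \<in> F y}"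
      moreover have "closedin X (F y)"
        unfolding F_def by (intro closedin_Int closedin_closure_of cl)
      ultimately obtain q where "q \<in> generics" "q \<in> F y"
        using visited_closed_contains_generic[of "F y"] by auto
      \<comment> \<open>The only generic point in the closure of \<open>y\<close> is
        \<open>y\<close> itself, where \<open>g\<close> stays below
        \<open>g y + \<epsilon>\<close>.\<close>
      then show False
        using generics_antichain[OF that, of q] \<open>\<epsilon> > 0\<close> by (auto simp: F_def)
    qed
    then have "zero_density (\<Union>y\<in>generics. {k. xs k \<in> F y})"
      using finite_generics by (rule zero_density_UN[rotated])
    then show "zero_density {k. g (xs k) - g (p k) \<ge> \<epsilon>}"
      by (rule zero_density_mono) (use p xs_topspace in \<open>auto simp: F_def algebra_simps\<close>)
  qed
  moreover have "(\<lambda>n. (\<Sum>k<n. g (p k)) / real n) \<longlonglongrightarrow> (\<Sum>k<r. g (p k)) / real r"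
    using r per by (intro average_periodic) auto
  ultimately have "(\<lambda>n. (\<Sum>k<n. g (xs k) - g (p k)) / real n + (\<Sum>k<n. g (p k)) / real n)
      \<longlonglongrightarrow> 0 + (\<Sum>k<r. g (p k)) / real r"
    by (rule tendsto_add)
  then show ?thesis by (simp add: sum_subtractf diff_divide_distrib)
qed

lemma average_SC:
  assumes "\<tau> \<in> SC X" and p: "\<And>k. p k \<in> generics" "\<And>k. xs k \<in> X closure_of {p k}"
    and r: "r \<ge> 1" and per: "\<And>k. p (k + r) = p k"
  shows "(\<lambda>n. (\<Sum>k<n. \<tau> (xs k)) / real n) \<longlonglongrightarrow> (\<Sum>k<r. \<tau> (p k)) / real r"
proof -
  obtain g h where gh: "bounded_usc X g" "bounded_usc X h"
    and \<tau>: "\<And>x. x \<in> topspace X \<Longrightarrow> \<tau> x = g x - h x"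
    using assms(1) by (auto simp: SC_def)
  have "(\<lambda>n. (\<Sum>k<n. g (xs k)) / real n - (\<Sum>k<n. h (xs k)) / real n)
      \<longlonglongrightarrow> (\<Sum>k<r. g (p k)) / real r - (\<Sum>k<r. h (p k)) / real r"
    by (intro tendsto_diff average_usc gh p r per)
  moreover have "\<tau> (xs k) = g (xs k) - h (xs k)" "\<tau> (p k) = g (p k) - h (p k)" for k
    using \<tau> xs_topspace p(1) generics_topspace by auto
  ultimately show ?thesis by (simp add: sum_subtractf diff_divide_distrib)
qed

end

theorem theoremF:
  fixes X :: "'a topology" and f :: "'a \<Rightarrow> 'a" and x :: 'a and xs :: "nat \<Rightarrow> 'a"
  assumes "zariski_space X"
    and "continuous_map X X f"
    and "f ` topspace X = topspace X"
    and "x \<in> topspace X"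
    and "reverse_orbit X f x xs"
  shows "\<exists>(r::nat) (y :: nat \<Rightarrow> 'a).
    r \<ge> 1 \<and> inj_on y {1..r} \<and> periodic_cycle X f (y ` {1..r}) \<and>
    converges_weakly X
      (\<lambda>n. scale_measure (ennreal (1 / real n))
             (sum_measure (borel_measure_space X) {0..<n} (\<lambda>k. dirac X (xs k))))
      (scale_measure (ennreal (1 / real r))
             (sum_measure (borel_measure_space X) {1..r} (\<lambda>i. dirac X (y i)))) \<and>
    y ` {1..r} =
      {p. \<exists>C \<in> irreducible_components X (X closure_of (range xs)). generic_point X C p}"
proof -
  have xs: "xs n \<in> topspace X" for n
    using assms(5) by (simp add: reverse_orbit_def)
  interpret zariski_reverse_orbit X f xs
  proof
    show "f (xs (Suc n)) = xs n" for n
      using assms(5) unfolding reverse_orbit_def by (metis diff_Suc_1 le_add1 plus_1_eq_Suc)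
  qed (use assms xs in auto)
  obtain p r where r: "r \<ge> (1::nat)" and inj: "inj_on p {1..r}" and img: "p ` {1..r} = generics"
    and per: "\<And>k. p (k + r) = p k" and cl: "\<And>k. xs k \<in> X closure_of {p k}"
    and range: "\<And>k. p k \<in> generics"
    by (rule generics_periodic) (rule that; assumption)
  have p: "p k \<in> topspace X" for k using range generics_topspace by blast
  have "converges_weakly X
      (\<lambda>n. scale_measure (ennreal (1 / real n))
             (sum_measure (borel_measure_space X) {0..<n} (\<lambda>k. dirac X (xs k))))
      (scale_measure (ennreal (1 / real r))
             (sum_measure (borel_measure_space X) {1..r} (\<lambda>i. dirac X (p i))))"
    unfolding converges_weakly_def
  proof (intro conjI allI ballI)
    fix \<tau> assume \<tau>: "\<tau> \<in> SC X"
    \<comment> \<open>The cycle is indexed by \<open>{1..r}\<close> but the averages by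
      \<open>{..<r}\<close>; the sums agree because \<open>p r = p 0\<close>.\<close>
    have "(\<Sum>i\<in>{1..r}. \<tau> (p i)) + \<tau> (p 0) = (\<Sum>k<r. \<tau> (p k)) + \<tau> (p r)"
      using sum.lessThan_Suc_shift[of "\<lambda>k. \<tau> (p k)" r] by (simp add: sum.atLeast1_atMost_eq)
    then have "(\<Sum>i\<in>{1..r}. \<tau> (p i)) = (\<Sum>k<r. \<tau> (p k))"
      using per[of 0] by simp
    then show "(\<lambda>n. \<integral>x. \<tau> x \<partial>scale_measure (ennreal (1 / real n))
             (sum_measure (borel_measure_space X) {0..<n} (\<lambda>k. dirac X (xs k))))
        \<longlonglongrightarrow> (\<integral>x. \<tau> x \<partial>scale_measure (ennreal (1 / real r))
             (sum_measure (borel_measure_space X) {1..r} (\<lambda>i. dirac X (p i))))"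
      using average_SC[OF \<tau> range cl r per] \<tau> xs p
      by (simp add: integral_scale_sum_dirac lessThan_atLeast0)
  \<comment> \<open>Finiteness is required for \<open>n = 0\<close> as well: there the coefficient
    \<open>1 / real 0\<close> is 0 and the measure is zero.\<close>
  qed (use xs p in \<open>auto intro!: finite_borel_measure_scale_sum_dirac\<close>)
  moreover have "periodic_cycle X f generics"
    using finite_generics generics_topspace cyclic_on_generics by (auto simp: periodic_cycle_def)
  ultimately show ?thesis
    using r inj img by (intro exI[of _ r] exI[of _ p]) (simp add: generics_def)
qed

end
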